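(* The price of anarchy, with respect to liquid welfare, of coarse correlated equilibria of generalized first-price (GFP) auctions with budgets is at least $$\frac{2+\mathcal W_0(-e^{-2})}{1+\mathcal W_0(-e^{-2})}\approx2.188.$$ That is, the supremum of $\mathrm{OPT}(I)/\mathrm{LW}(I,A)$ over all such instances $I$ and all coarse correlated equilibria $A$ of $I$ is at least this number.
   Context: $\mathcal W_0$ is the principal real branch of the Lambert function: $\mathcal W_0(-e^{-2})$ is the unique $w\in[-1,0)$ with $we^w=-e^{-2}$. GFP auction: bidders $N=[n]$, $n\ge2$, and $m\le n$ slots with click-through rates $\alpha_1\ge\alpha_2\ge\dots\ge\alpha_m>0$; set $\alpha_0=0$. Bidder $i$ submits a scalar bid $a_i\in\mathcal A_i=\mathbb R_{\ge0}$; $\mathcal A=\mathbb R_{\ge0}^n$. Bidders are ranked in non-increasing order of their bids, with ties broken consistently, and slot $j\in[m]$ is assigned to the $j$-th ranked bidder. $X_i(a)\in\{0,1,\dots,m\}$ is the slot of bidder $i$ ($0$ meaning no slot). Bidder $i$ pays $P_i(a)=\alpha_{X_i(a)}a_i$. Bidder $i$ has a value per click $\bar v_i\ge0$, giving valuation $v_i(j)=\bar v_i\alpha_j$, and a budget $B_i\in(0,\infty]$. Utility: $u_i(a)=v_i(X_i(a))-P_i(a)$. Feasible allocations $\mathcal X$: profiles $x\in\{0,\dots,m\}^n$ in which no slot $j\ge1$ is assigned to two bidders. An instance $I$ consists of the bidders, the slots with their click-through rates, the values per click and the budgets. $\Delta(S)$ denotes probability distributions on $S$. For $A\in\Delta(\mathcal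 A)$ let $A_{-i}$ be the marginal on the others' actions, and let $\mathcal C_i(A_{-i})$ be the set of $A_i'\in\Delta(\mathcal A_i)$ with $\mathbb E_{a_i'\sim A_i',a_{-i}\sim A_{-i}}[P_i(a_i',a_{-i})]\le B_i$ (independent draws). $A\in\Delta(\mathcal A)$ is a coarse correlated equilibrium if for all $i$: $\mathbb E_{a\sim A}[P_i(a)]\le B_i$, and $\mathbb E_{a\sim A}[u_i(a)]\ge\mathbb E_{a_i'\sim A_i',a_{-i}\sim A_{-i}}[u_i(a_i',a_{-i})]$ for all $A_i'\in\mathcal C_i(A_{-i})$. $\mathrm{LW}(I,A)=\sum_i\min\{\mathbb E_{a\sim A}[v_i(X_i(a))],B_i\}$ and $\mathrm{OPT}(I)=\max_{\chi\in\Delta(\mathcal X)}\sum_i\min\{\mathbb E_{x\sim\chi}[v_i(x_i)],B_i\}$. *)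

theory Defs
  imports "HOL-Probability.Probability"
begin

definition lambert_W0 :: "real \<Rightarrow> real" where
  "lambert_W0 x = (THE w. - 1 \<le> w \<and> w * exp w = x)"

lemma lambert_W0_unique:
  assumes "- exp (- 1) \<le> x"
  shows "\<exists>!w. - 1 \<le> w \<and> w * exp w = (x :: real)"
proof -
  have mono: "v * exp v < w * exp w" if "- 1 \<le> v" "v < w" for v w :: real
  proof (rule DERIV_pos_imp_increasing_open[OF \<open>v < w\<close>])
    fix z assume "v < z" "z < w"
    then have "0 < exp z + z * exp z"
      using that(1) mult_pos_pos[of "1 + z" "exp z"] by (simp add: algebra_simps)
    moreover have "((\<lambda>z. z * exp z) has_real_derivative exp z + z * exp z) (at z)"
      by (auto intro!: derivative_eq_intros)
    ultimately show "\<exists>y. ((\<lambda>z. z * exp z) has_real_derivative y) (at z) \<and> 0 < y"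
      by blast
  qed (intro continuous_intros)
  have "x \<le> \<bar>x\<bar> * exp \<bar>x\<bar>"
    using mult_left_mono[of 1 "exp \<bar>x\<bar>" "\<bar>x\<bar>"] by simp
  then have "\<exists>w\<ge>- 1. w \<le> \<bar>x\<bar> \<and> w * exp w = x"
    using assms by (intro IVT') (auto intro!: continuous_intros)
  then show ?thesis
    by (metis linorder_neqE_linordered_idom mono order_less_irrefl)
qed

text \<open>Bidders are \<open>0, \<dots>, n - 1\<close>, slots are \<open>1, \<dots>, m\<close>, and slot \<open>0\<close> means ``no slot''.\<close>

record gfp_instance =
  num_bidders :: nat
  num_slots :: nat
  ctr :: "nat \<Rightarrow> real"
  click_value :: "nat \<Rightarrow> real"
  budget :: "nat \<Rightarrow> ereal"

definition valid_instance :: "gfp_instance \<Rightarrow> bool" where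
  "valid_instance I \<longleftrightarrow>
     2 \<le> num_bidders I \<and> 1 \<le> num_slots I \<and> num_slots I \<le> num_bidders I \<and>
     ctr I 0 = 0 \<and>
     (\<forall>j\<in>{1..num_slots I}. 0 < ctr I j) \<and>
     (\<forall>j\<in>{1..num_slots I}. \<forall>k\<in>{1..num_slots I}. j \<le> k \<longrightarrow> ctr I k \<le> ctr I j) \<and>
     (\<forall>i<num_bidders I. 0 \<le> click_value I i \<and> 0 < budget I i)"

definition valuation :: "gfp_instance \<Rightarrow> nat \<Rightarrow> nat \<Rightarrow> real" where
  "valuation I i j = click_value I i * ctr I j"

text \<open>A tie-breaking rule of the auction format fixes, for every number \<open>n\<close> of bidders, a priority
  order on the bidders: among equal bids, the bidder \<open>i\<close> with the smaller \<open>\<tau> n i\<close> is ranked first.\<close>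

definition tie_breaking :: "(nat \<Rightarrow> nat \<Rightarrow> nat) \<Rightarrow> bool" where
  "tie_breaking \<tau> \<longleftrightarrow> (\<forall>n. inj_on (\<tau> n) {..<n})"

definition ranked_before ::
    "(nat \<Rightarrow> nat \<Rightarrow> nat) \<Rightarrow> gfp_instance \<Rightarrow> (nat \<Rightarrow> real) \<Rightarrow> nat \<Rightarrow> nat \<Rightarrow> bool" where
  "ranked_before \<tau> I a k i \<longleftrightarrow>
     a i < a k \<or> (a k = a i \<and> \<tau> (num_bidders I) k < \<tau> (num_bidders I) i)"

definition rank ::
    "(nat \<Rightarrow> nat \<Rightarrow> nat) \<Rightarrow> gfp_instance \<Rightarrow> (nat \<Rightarrow> real) \<Rightarrow> nat \<Rightarrow> nat" where
  "rank \<tau> I a i = Suc (card {k. k < num_bidders I \<and> ranked_before \<tau> I a k i})"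

definition slot ::
    "(nat \<Rightarrow> nat \<Rightarrow> nat) \<Rightarrow> gfp_instance \<Rightarrow> (nat \<Rightarrow> real) \<Rightarrow> nat \<Rightarrow> nat" where
  "slot \<tau> I a i = (if rank \<tau> I a i \<le> num_slots I then rank \<tau> I a i else 0)"

definition payment ::
    "(nat \<Rightarrow> nat \<Rightarrow> nat) \<Rightarrow> gfp_instance \<Rightarrow> nat \<Rightarrow> (nat \<Rightarrow> real) \<Rightarrow> real" where
  "payment \<tau> I i a = ctr I (slot \<tau> I a i) * a i"

definition utility ::
    "(nat \<Rightarrow> nat \<Rightarrow> nat) \<Rightarrow> gfp_instance \<Rightarrow> nat \<Rightarrow> (nat \<Rightarrow> real) \<Rightarrow> real" where
  "utility \<tau> I i a = valuation I i (slot \<tau> I a i) - payment \<tau> I i a"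

text \<open>Bids are unbounded, so an expected payment may be \<open>\<infinity>\<close> and an expected utility \<open>-\<infinity>\<close>, whereas
  the Bochner integral of a non-integrable function is \<open>0\<close>. Hence expectations are taken in the
  extended reals, as the integral of the positive part minus that of the negative part
  (\<open>ennreal\<close> maps negative numbers to \<open>0\<close>). Payments are nonnegative, and valuations are bounded,
  which bounds utilities from above, so \<open>\<infinity> - \<infinity>\<close> does not arise.\<close>

definition expect :: "'a measure \<Rightarrow> ('a \<Rightarrow> real) \<Rightarrow> ereal" where
  "expect M f =
     enn2ereal (\<integral>\<^sup>+x. ennreal (f x) \<partial>M) - enn2ereal (\<integral>\<^sup>+x. ennreal (- f x) \<partial>M)"

definition bid_space :: "real measure" where
  "bid_space = restrict_space borel {0..}"

definition profile_space :: "nat set \<Rightarrow> (nat \<Rightarrow> real) measure" where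
  "profile_space N = Pi\<^sub>M N (\<lambda>_. bid_space)"

definition others :: "gfp_instance \<Rightarrow> nat \<Rightarrow> nat set" where
  "others I i = {..<num_bidders I} - {i}"

definition marginal_others ::
    "gfp_instance \<Rightarrow> nat \<Rightarrow> (nat \<Rightarrow> real) measure \<Rightarrow> (nat \<Rightarrow> real) measure" where
  "marginal_others I i A = distr A (profile_space (others I i)) (\<lambda>a. restrict a (others I i))"

text \<open>Expectation of \<open>f\<close> when bidder \<open>i\<close> draws her bid from \<open>D\<close>, independently of the others' bids,
  which are drawn from \<open>Q\<close>.\<close>

definition deviation_expect ::
    "nat \<Rightarrow> real measure \<Rightarrow> (nat \<Rightarrow> real) measure \<Rightarrow> ((nat \<Rightarrow> real) \<Rightarrow> real) \<Rightarrow> ereal" where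
  "deviation_expect i D Q f = expect (D \<Otimes>\<^sub>M Q) (\<lambda>(x, b). f (b(i := x)))"

definition feasible_deviations ::
    "(nat \<Rightarrow> nat \<Rightarrow> nat) \<Rightarrow> gfp_instance \<Rightarrow> nat \<Rightarrow> (nat \<Rightarrow> real) measure \<Rightarrow> real measure set" where
  "feasible_deviations \<tau> I i Q =
     {D \<in> space (prob_algebra bid_space). deviation_expect i D Q (payment \<tau> I i) \<le> budget I i}"

definition coarse_correlated_equilibrium ::
    "(nat \<Rightarrow> nat \<Rightarrow> nat) \<Rightarrow> gfp_instance \<Rightarrow> (nat \<Rightarrow> real) measure \<Rightarrow> bool" where
  "coarse_correlated_equilibrium \<tau> I A \<longleftrightarrow>
     A \<in> space (prob_algebra (profile_space {..<num_bidders I})) \<and>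
     (\<forall>i<num_bidders I.
        expect A (payment \<tau> I i) \<le> budget I i \<and>
        (\<forall>D\<in>feasible_deviations \<tau> I i (marginal_others I i A).
           deviation_expect i D (marginal_others I i A) (utility \<tau> I i)
             \<le> expect A (utility \<tau> I i)))"

definition liquid_welfare ::
    "(nat \<Rightarrow> nat \<Rightarrow> nat) \<Rightarrow> gfp_instance \<Rightarrow> (nat \<Rightarrow> real) measure \<Rightarrow> ereal" where
  "liquid_welfare \<tau> I A =
     (\<Sum>i<num_bidders I. min (expect A (\<lambda>a. valuation I i (slot \<tau> I a i))) (budget I i))"

definition feasible_allocations :: "gfp_instance \<Rightarrow> (nat \<Rightarrow> nat) set" where
  "feasible_allocations I =
     {x \<in> {..<num_bidders I} \<rightarrow>\<^sub>E {0..num_slots I}.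
        \<forall>i<num_bidders I. \<forall>k<num_bidders I. i \<noteq> k \<longrightarrow> x i = x k \<longrightarrow> x i = 0}"

text \<open>The set of allocations is finite, so the maximum defining the optimum exists and equals the
  supremum below.\<close>

definition optimal_liquid_welfare :: "gfp_instance \<Rightarrow> ereal" where
  "optimal_liquid_welfare I =
     (SUP \<xi>\<in>{\<xi>. set_pmf \<xi> \<subseteq> feasible_allocations I}.
        \<Sum>i<num_bidders I.
          min (expect (measure_pmf \<xi>) (\<lambda>x. valuation I i (x i))) (budget I i))"

text \<open>In \<open>ereal\<close>, \<open>0 / 0 = 0\<close>, so degenerate instances (all values zero) do not affect the
  supremum.\<close>

definition price_of_anarchy :: "(nat \<Rightarrow> nat \<Rightarrow> nat) \<Rightarrow> ereal" where
  "price_of_anarchy \<tau> =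
     (SUP (I, A)\<in>{(I, A). valid_instance I \<and> coarse_correlated_equilibrium \<tau> I A}.
        optimal_liquid_welfare I / liquid_welfare \<tau> I A)"

end

theory Submission
  imports Defs
begin

text \<open>One slot and two bidders suffice. Let \<open>t = - \<W>\<^sub>0 (- e\<^sup>-\<^sup>2)\<close>, so that
  \<open>ln t = t - 2\<close>. Bidder \<open>p\<close>, who wins ties, has value \<open>1\<close> and no budget; bidder \<open>q\<close> has a huge
  value \<open>V\<close> and budget \<open>B = 1 - t + t ln t\<close>. Let \<open>X\<close> be supported on \<open>[0, 1 - t]\<close> with
  \<open>P (X \<le> x) = t / (1 - x)\<close>, which makes all bids of \<open>p\<close> in \<open>[0, 1 - t]\<close> against \<open>X\<close> equally good,
  with utility \<open>t\<close>. Bidders \<open>q\<close> and \<open>p\<close> bid \<open>X\<close> and \<open>\<theta> X\<close> for some \<open>\<theta> < 1\<close> close to \<open>1\<close>. Then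
  \<open>p\<close> wins exactly when \<open>X = 0\<close>, for free and with probability \<open>t\<close>, whereas \<open>q\<close> pays \<open>E X = B\<close>
  in expectation. A deviation of \<open>q\<close> within her budget wins with probability at most
  \<open>t + B / \<theta>\<close>, which is below \<open>1 - t\<close>. The liquid welfare is \<open>B + t = (1 - t)\<^sup>2\<close>, but as \<open>V\<close> grows
  the optimum tends to \<open>B + 1 = (2 - t) (1 - t)\<close>, since \<open>q\<close> reaches her budget with probability
  \<open>B / V\<close>.\<close>

section \<open>Expectations in the extended reals\<close>

lemma expect_has_bochner_integral:
  fixes f :: "'a \<Rightarrow> real"
  assumes "has_bochner_integral M f c"
  shows "expect M f = ereal c"
proof -
  have f: "integrable M f" and c: "integral\<^sup>L M f = c"
    using assms by (auto simp: has_bochner_integral_iff)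
  have "(\<integral>\<^sup>+ x. ennreal (f x) \<partial>M) < \<infinity>" "(\<integral>\<^sup>+ x. ennreal (- f x) \<partial>M) < \<infinity>"
    using f by (auto simp: real_integrable_def less_top)
  then show ?thesis
    using real_lebesgue_integral_def[OF f] c unfolding expect_def
    by (cases "\<integral>\<^sup>+ x. ennreal (f x) \<partial>M"; cases "\<integral>\<^sup>+ x. ennreal (- f x) \<partial>M") auto
qed

lemma expect_distr:
  assumes "g \<in> M \<rightarrow>\<^sub>M N" "f \<in> borel_measurable N"
  shows "expect (distr M N g) f = expect M (\<lambda>x. f (g x))"
  using assms by (simp add: expect_def nn_integral_distr)

text \<open>Dropping the negative part can only increase the value. Utilities of deviations are thus
  bounded by nonnegative integrals, with no question of integrability.\<close>

lemma expect_le_nn_integral: "expect M f \<le> enn2ereal (\<integral>\<^sup>+ x. ennreal (f x) \<partial>M)"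
  unfolding expect_def
  using ereal_minus_mono[of _ _ 0 "enn2ereal (\<integral>\<^sup>+ x. ennreal (- f x) \<partial>M)"] by fastforce

lemma expect_nonneg_eq:
  assumes "\<And>x. x \<in> space M \<Longrightarrow> 0 \<le> f x"
  shows "expect M f = enn2ereal (\<integral>\<^sup>+ x. ennreal (f x) \<partial>M)"
proof -
  have "(\<integral>\<^sup>+ x. ennreal (- f x) \<partial>M) = (\<integral>\<^sup>+ x. 0 \<partial>M)"
    using assms by (intro nn_integral_cong) (simp add: ennreal_neg)
  then show ?thesis
    by (simp add: expect_def zero_ennreal.rep_eq)
qed

lemma ennreal_plus_le: "ennreal (a + b) \<le> ennreal a + ennreal b"
proof -
  have "ennreal (a + b) \<le> ennreal (max 0 a + max 0 b)"
    by (intro ennreal_leI) linarith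
  then show ?thesis
    by simp
qed

section \<open>Measurability of bids and bid profiles\<close>

lemma measurable_bid_space_borel [measurable]: "(\<lambda>x. x) \<in> bid_space \<rightarrow>\<^sub>M borel"
  unfolding bid_space_def by (rule measurable_restrict_space1) simp

lemma space_bid_space [simp]: "space bid_space = {0..}"
  by (simp add: bid_space_def space_restrict_space)

lemma measurable_into_bid_space:
  assumes "f \<in> borel_measurable M" "\<And>x. x \<in> space M \<Longrightarrow> 0 \<le> f x"
  shows "f \<in> M \<rightarrow>\<^sub>M bid_space"
  unfolding bid_space_def using assms by (intro measurable_restrict_space2) auto

lemma measurable_profile_component:
  assumes "i \<in> N"
  shows "(\<lambda>a. a i) \<in> borel_measurable (profile_space N)"
proof -
  have "(\<lambda>a. a i) \<in> profile_space N \<rightarrow>\<^sub>M bid_space"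
    unfolding profile_space_def using assms by (rule measurable_component_singleton)
  from measurable_compose[OF this measurable_bid_space_borel] show ?thesis .
qed

section \<open>The uniform variable and the equal-revenue distribution\<close>

text \<open>The common source of randomness of both bids. The point 0 is left out because
  \<open>t / 0 = 0\<close> would make the equal-revenue bid there 1.\<close>

definition unit_uniform :: "real measure" where
  "unit_uniform = restrict_space lborel {0<..1}"

lemma space_unit_uniform [simp]: "space unit_uniform = {0<..1}"
  by (simp add: unit_uniform_def space_restrict_space)

lemma measurable_unit_uniform:
  "f \<in> borel_measurable borel \<Longrightarrow> f \<in> borel_measurable unit_uniform"
  unfolding unit_uniform_def by (rule measurable_restrict_space1) simp

interpretation unit_uniform: prob_space unit_uniform
  by standard (simp add: unit_uniform_def emeasure_restrict_space space_restrict_space)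

lemma has_bochner_integral_unit_uniform:
  fixes f :: "real \<Rightarrow> real"
  assumes "has_bochner_integral lborel (\<lambda>u. indicator {0<..1} u *\<^sub>R f u) c"
  shows "has_bochner_integral unit_uniform f c"
  using assms by (simp add: unit_uniform_def has_bochner_integral_restrict_space)

text \<open>If \<open>u\<close> is uniform on the unit interval, then this has distribution function
  \<open>x \<mapsto> t / (1 - x)\<close> on \<open>[0, 1 - t]\<close>.\<close>

definition equal_revenue_bid :: "real \<Rightarrow> real \<Rightarrow> real" where
  "equal_revenue_bid t u = max 0 (1 - t / u)"

lemma equal_revenue_bid_nonneg [simp]: "0 \<le> equal_revenue_bid t u"
  by (simp add: equal_revenue_bid_def)

lemma measurable_equal_revenue_bid [measurable]: "equal_revenue_bid t \<in> borel_measurable borel"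
  unfolding equal_revenue_bid_def[abs_def] by measurable

lemma equal_revenue_bid_eq:
  "0 < u \<Longrightarrow> equal_revenue_bid t u = (if t < u then 1 - t / u else 0)"
  by (simp add: equal_revenue_bid_def max_def field_simps)

lemma equal_revenue_bid_le_0_iff: "0 < u \<Longrightarrow> equal_revenue_bid t u \<le> 0 \<longleftrightarrow> u \<le> t"
  by (simp add: equal_revenue_bid_def field_simps)

text \<open>For \<open>z < 1\<close> the event is \<open>u \<le> t / (1 - z)\<close>, of probability
  at most \<open>t / (1 - z)\<close>; this ratio may exceed 1, hence the inequality. For
  \<open>z \<ge> 1\<close> the integrand is truncated to 0 by \<open>ennreal\<close>.\<close>

lemma equal_revenue_bid_cdf:
  assumes "0 < t" "0 \<le> z"
  shows "(\<integral>\<^sup>+ u. ennreal ((1 - z) * of_bool (equal_revenue_bid t u \<le> z)) \<partial>unit_uniform) \<le> ennreal t"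
proof (cases "z < 1")
  case True
  have "(\<integral>\<^sup>+ u. ennreal ((1 - z) * of_bool (equal_revenue_bid t u \<le> z)) \<partial>unit_uniform)
      = (\<integral>\<^sup>+ u. ennreal ((1 - z) * of_bool (equal_revenue_bid t u \<le> z)) * indicator {0<..1} u \<partial>lborel)"
    unfolding unit_uniform_def by (rule nn_integral_restrict_space) simp
  also have "\<dots> \<le> (\<integral>\<^sup>+ u. ennreal (1 - z) * indicator {0..t / (1 - z)} u \<partial>lborel)"
    using True by (intro nn_integral_mono)
      (auto simp: indicator_def equal_revenue_bid_def field_simps split: if_splits)
  also have "\<dots> = ennreal (1 - z) * ennreal (t / (1 - z))"
    using True assms by (simp add: nn_integral_cmult_indicator)
  also have "\<dots> = ennreal t"
    using True assms by (simp flip: ennreal_mult)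
  finally show ?thesis .
next
  case False
  then have "(\<integral>\<^sup>+ u. ennreal ((1 - z) * of_bool (equal_revenue_bid t u \<le> z)) \<partial>unit_uniform)
      = (\<integral>\<^sup>+ u. 0 \<partial>unit_uniform)"
    by (intro nn_integral_cong) (auto simp: ennreal_neg)
  then show ?thesis
    by simp
qed

lemma integral_equal_revenue_bid:
  assumes "0 < t" "t < 1"
  shows "has_bochner_integral unit_uniform (equal_revenue_bid t) (1 - t + t * ln t)"
proof (rule has_bochner_integral_unit_uniform)
  \<comment> \<open>The bid vanishes for \<open>u \<le> t\<close>; on \<open>[t, 1]\<close> it has
    the antiderivative \<open>u - t * ln u\<close>.\<close>
  have "has_bochner_integral lborel (\<lambda>u. (1 - t / u) * indicator {t..1} u)
      ((1 - t * ln 1) - (t - t * ln t))"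
    using assms by (intro has_bochner_integral_FTC_Icc_real)
      (auto intro!: derivative_eq_intros continuous_intros)
  then show "has_bochner_integral lborel (\<lambda>u. indicator {0<..1} u *\<^sub>R equal_revenue_bid t u)
      (1 - t + t * ln t)"
    using assms
    by (elim has_bochner_integral_cong[THEN iffD1, rotated -1])
      (auto simp: equal_revenue_bid_eq indicator_def)
qed

lemma probability_above:
  assumes "0 < t" "t < 1"
  shows "has_bochner_integral unit_uniform (\<lambda>u. of_bool (t < u)) (1 - t)"
proof (rule has_bochner_integral_unit_uniform)
  have "has_bochner_integral lborel (indicator {t<..1}) (measure lborel {t<..1})"
    using assms by (intro has_bochner_integral_real_indicator) auto
  then show "has_bochner_integral lborel (\<lambda>u. indicator {0<..1} u *\<^sub>R of_bool (t < u)) (1 - t)"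
    using assms
    by (elim has_bochner_integral_cong[THEN iffD1, rotated -1])
      (auto simp: indicator_def)
qed

section \<open>The two-bidder instance and its outcomes\<close>

definition two_bidder_instance :: "real \<Rightarrow> real \<Rightarrow> nat \<Rightarrow> gfp_instance" where
  "two_bidder_instance V B p =
     \<lparr>num_bidders = 2, num_slots = 1, ctr = (\<lambda>j. of_bool (j = 1)),
      click_value = (\<lambda>i. if i = p then 1 else V),
      budget = (\<lambda>i. if i = p then \<infinity> else ereal B)\<rparr>"

lemma two_bidder_instance_simps [simp]:
  "num_bidders (two_bidder_instance V B p) = 2"
  "num_slots (two_bidder_instance V B p) = 1"
  "ctr (two_bidder_instance V B p) j = of_bool (j = 1)"
  "click_value (two_bidder_instance V B p) i = (if i = p then 1 else V)"
  "budget (two_bidder_instance V B p) i = (if i = p then \<infinity> else ereal B)"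
  by (simp_all add: two_bidder_instance_def)

text \<open>The names \<open>p\<close> and \<open>q\<close> stay abstract because \<tau> decides who
  wins ties. In \<open>slack\<close>, the left side bounds the utility of \<open>q\<close> from any
  affordable deviation and the right side is her equilibrium utility.\<close>

locale two_bidder_example =
  fixes \<tau> :: "nat \<Rightarrow> nat \<Rightarrow> nat" and p q :: nat and t \<theta> V B :: real
  assumes bidders: "{..<2} = {p, q}" and priority: "\<tau> 2 p < \<tau> 2 q"
    and t: "0 < t" "t < 1" and \<theta>: "0 < \<theta>" "\<theta> < 1"
    and B_eq: "B = 1 - t + t * ln t" and B: "0 < B" "B \<le> V"
    and slack: "V * (t + B / \<theta>) \<le> V * (1 - t) - B"
begin

abbreviation I where "I \<equiv> two_bidder_instance V B p"

lemma p_neq_q [simp]: "p \<noteq> q" "q \<noteq> p"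
  using priority by auto

lemma less_2_iff: "i < 2 \<longleftrightarrow> i = p \<or> i = q"
proof -
  have "i < 2 \<longleftrightarrow> i \<in> {..<2}"
    by simp
  then show ?thesis
    unfolding bidders by simp
qed

lemma sum_bidders: "(\<Sum>i<2. f i) = f p + (f q :: ereal)"
  unfolding bidders by simp

lemma others_p: "others I p = {q}" and others_q: "others I q = {p}"
  unfolding others_def two_bidder_instance_simps bidders by auto

text \<open>With one opponent the rank is 1 or 2, and rank 2 exceeds the single slot and so becomes
  slot 0.\<close>

lemma slot_eq_1_iff:
  assumes "{i, j} = {p, q}"
  shows "slot \<tau> I a i = of_bool (\<not> ranked_before \<tau> I a j i)"
proof -
  have "\<not> ranked_before \<tau> I a i i"
    by (simp add: ranked_before_def)
  then have "{k. k < 2 \<and> ranked_before \<tau> I a k i} = (if ranked_before \<tau> I a j i then {j} else {})"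
    using assms by (auto simp: less_2_iff doubleton_eq_iff)
  then show ?thesis
    by (simp add: slot_def rank_def)
qed

lemma slot_p: "slot \<tau> I a p = of_bool (a q \<le> a p)"
  using priority by (subst slot_eq_1_iff[of p q]) (auto simp: ranked_before_def)

lemma slot_q: "slot \<tau> I a q = of_bool (a p < a q)"
  using priority by (subst slot_eq_1_iff[of q p]) (auto simp: ranked_before_def)

lemma outcome_p:
  "valuation I p (slot \<tau> I a p) = of_bool (a q \<le> a p)"
  "payment \<tau> I p a = of_bool (a q \<le> a p) * a p"
  "utility \<tau> I p a = (1 - a p) * of_bool (a q \<le> a p)"
  by (simp_all add: utility_def payment_def valuation_def slot_p)

lemma outcome_q:
  "valuation I q (slot \<tau> I a q) = V * of_bool (a p < a q)"
  "payment \<tau> I q a = a q * of_bool (a p < a q)"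
  "utility \<tau> I q a = (V - a q) * of_bool (a p < a q)"
  by (simp_all add: utility_def payment_def valuation_def slot_q)

section \<open>The equilibrium distribution and its marginals\<close>

definition bid :: "nat \<Rightarrow> real \<Rightarrow> real" where
  "bid i u = (if i = p then \<theta> * equal_revenue_bid t u else equal_revenue_bid t u)"

lemma bid_nonneg [simp]: "0 \<le> bid i u"
  using \<theta> by (simp add: bid_def)

lemma measurable_bid [measurable]: "bid i \<in> borel_measurable borel"
  unfolding bid_def[abs_def] by measurable

lemma measurable_bid_profile:
  "(\<lambda>u. \<lambda>i\<in>N. bid i u) \<in> unit_uniform \<rightarrow>\<^sub>M profile_space N"
  unfolding profile_space_def
  by (intro measurable_restrict measurable_into_bid_space measurable_unit_uniform) auto

text \<open>Both bids are functions of the same \<open>u\<close>, so \<open>q\<close> can outbid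
  \<open>p\<close> by a small margin in every draw. A deviator faces only the marginal, independent
  of the deviating bid.\<close>

definition equilibrium :: "(nat \<Rightarrow> real) measure" where
  "equilibrium = distr unit_uniform (profile_space {..<2}) (\<lambda>u. \<lambda>i\<in>{..<2}. bid i u)"

lemma equilibrium_in_prob_algebra: "equilibrium \<in> space (prob_algebra (profile_space {..<2}))"
  unfolding equilibrium_def space_prob_algebra
  by (simp add: unit_uniform.prob_space_distr[OF measurable_bid_profile])

lemma marginal_equilibrium:
  assumes "j < 2" "others I i = {j}"
  shows "marginal_others I i equilibrium =
    distr unit_uniform (profile_space {j}) (\<lambda>u. \<lambda>k\<in>{j}. bid k u)"
proof -
  have "(\<lambda>a. restrict a {j}) \<in> profile_space {..<2} \<rightarrow>\<^sub>M profile_space {j}"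
    unfolding profile_space_def using assms by (intro measurable_restrict_subset) auto
  then have "marginal_others I i equilibrium = distr unit_uniform (profile_space {j})
      ((\<lambda>a. restrict a {j}) \<circ> (\<lambda>u. \<lambda>i\<in>{..<2}. bid i u))"
    unfolding marginal_others_def assms equilibrium_def by (rule distr_distr[OF _ measurable_bid_profile])
  also have "((\<lambda>a. restrict a {j}) \<circ> (\<lambda>u. \<lambda>i\<in>{..<2}. bid i u)) = (\<lambda>u. \<lambda>k\<in>{j}. bid k u)"
    using assms by (auto simp: fun_eq_iff)
  finally show ?thesis .
qed

text \<open>Tonelli, followed by a change of variables to \<open>u\<close>. The integrand
  \<open>h\<close> is kept general so that it covers utilities of both bidders and payments of
  \<open>q\<close>.\<close>

lemma nn_integral_deviation:
  fixes h :: "real \<Rightarrow> real \<Rightarrow> ennreal"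
  assumes D: "D \<in> space (prob_algebra bid_space)" and j: "j < 2" "others I i = {j}"
    and h [measurable]: "(\<lambda>(x, y). h x y) \<in> borel_measurable (borel \<Otimes>\<^sub>M borel)"
  shows "(\<integral>\<^sup>+ (x, b). h x (b j) \<partial>(D \<Otimes>\<^sub>M marginal_others I i equilibrium))
    = (\<integral>\<^sup>+ x. \<integral>\<^sup>+ u. h x (bid j u) \<partial>unit_uniform \<partial>D)"
proof -
  define Q where "Q = distr unit_uniform (profile_space {j}) (\<lambda>u. \<lambda>k\<in>{j}. bid k u)"
  have sets_D [measurable_cong]: "sets D = sets bid_space"
    using D by (simp add: space_prob_algebra)
  have sets_Q [measurable_cong]: "sets Q = sets (profile_space {j})"
    by (simp add: Q_def)
  interpret Q: prob_space Q
    unfolding Q_def by (rule unit_uniform.prob_space_distr[OF measurable_bid_profile])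
  have [measurable]: "(\<lambda>b. b j) \<in> borel_measurable (profile_space {j})"
    by (rule measurable_profile_component) simp
  have "(\<lambda>(x, b). h x (b j)) \<in> borel_measurable (D \<Otimes>\<^sub>M Q)"
    by measurable
  then have "(\<integral>\<^sup>+ (x, b). h x (b j) \<partial>(D \<Otimes>\<^sub>M Q)) = (\<integral>\<^sup>+ x. \<integral>\<^sup>+ b. h x (b j) \<partial>Q \<partial>D)"
    by (simp flip: Q.nn_integral_fst)
  also have "\<dots> = (\<integral>\<^sup>+ x. \<integral>\<^sup>+ u. h x (bid j u) \<partial>unit_uniform \<partial>D)"
    unfolding Q_def by (subst nn_integral_distr[OF measurable_bid_profile]) auto
  finally show ?thesis
    unfolding marginal_equilibrium[OF j] Q_def .
qed

section \<open>Unprofitability of deviations\<close>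

text \<open>Each fixed bid against the equal-revenue bid of \<open>q\<close> earns at most
  \<open>t\<close>, hence so does every mixture of bids.\<close>

lemma deviation_p:
  assumes D: "D \<in> space (prob_algebra bid_space)"
  shows "deviation_expect p D (marginal_others I p equilibrium) (utility \<tau> I p) \<le> ereal t"
proof -
  interpret D: prob_space D
    using D by (simp add: space_prob_algebra)
  have sets_D: "sets D = sets bid_space"
    using D by (simp add: space_prob_algebra)
  have space_D: "space D = {0..}"
    using sets_eq_imp_space_eq[OF sets_D] by simp
  have "(\<integral>\<^sup>+ (x, b). ennreal ((1 - x) * of_bool (b q \<le> x)) \<partial>(D \<Otimes>\<^sub>M marginal_others I p equilibrium))
      = (\<integral>\<^sup>+ x. \<integral>\<^sup>+ u. ennreal ((1 - x) * of_bool (bid q u \<le> x)) \<partial>unit_uniform \<partial>D)"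
    by (rule nn_integral_deviation[OF D _ others_p]) (simp add: less_2_iff, measurable)
  also have "\<dots> \<le> (\<integral>\<^sup>+ x. ennreal t \<partial>D)"
    using t space_D by (intro nn_integral_mono) (simp add: bid_def equal_revenue_bid_cdf)
  also have "\<dots> = ennreal t"
    by (simp add: D.emeasure_space_1)
  finally have *: "(\<integral>\<^sup>+ (x, b). ennreal ((1 - x) * of_bool (b q \<le> x))
      \<partial>(D \<Otimes>\<^sub>M marginal_others I p equilibrium)) \<le> ennreal t" .
  have "deviation_expect p D (marginal_others I p equilibrium) (utility \<tau> I p)
      = expect (D \<Otimes>\<^sub>M marginal_others I p equilibrium) (\<lambda>(x, b). (1 - x) * of_bool (b q \<le> x))"
    by (simp add: deviation_expect_def outcome_p)
  also have "\<dots> \<le> enn2ereal (\<integral>\<^sup>+ (x, b). ennreal ((1 - x) * of_bool (b q \<le> x))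
      \<partial>(D \<Otimes>\<^sub>M marginal_others I p equilibrium))"
    by (rule order_trans[OF expect_le_nn_integral]) (simp add: case_prod_unfold)
  also have "\<dots> \<le> enn2ereal (ennreal t)"
    using * by (simp add: less_eq_ennreal.rep_eq)
  finally show ?thesis
    using t by simp
qed

text \<open>A duality argument: the budget constraint is priced with multiplier
  \<open>V / \<theta>\<close>. What remains of the utility is at most \<open>V\<close> times an
  equal-revenue payoff at \<open>x / \<theta>\<close>, hence at most \<open>V * t\<close>, and the
  priced payments add at most \<open>V * B / \<theta>\<close>.\<close>

lemma deviation_q:
  assumes "D \<in> feasible_deviations \<tau> I q (marginal_others I q equilibrium)"
  shows "deviation_expect q D (marginal_others I q equilibrium) (utility \<tau> I q)
    \<le> ereal (V * (1 - t) - B)"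
proof -
  have D: "D \<in> space (prob_algebra bid_space)"
    and pay: "deviation_expect q D (marginal_others I q equilibrium) (payment \<tau> I q) \<le> ereal B"
    using assms by (auto simp: feasible_deviations_def)
  interpret D: prob_space D
    using D by (simp add: space_prob_algebra)
  have sets_D [measurable_cong]: "sets D = sets bid_space"
    using D by (simp add: space_prob_algebra)
  have space_D: "space D = {0..}"
    using sets_eq_imp_space_eq[OF sets_D] by simp
  define win where "win x u = (of_bool (bid p u < x) :: real)" for x u
  \<comment> \<open>The budget constraint as a double integral; payments are nonnegative, so their
    expectation has no negative part.\<close>
  have pay_le: "(\<integral>\<^sup>+ x. \<integral>\<^sup>+ u. ennreal (x * win x u) \<partial>unit_uniform \<partial>D) \<le> ennreal B"
  proof -
    have "(\<integral>\<^sup>+ x. \<integral>\<^sup>+ u. ennreal (x * win x u) \<partial>unit_uniform \<partial>D)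
        = (\<integral>\<^sup>+ (x, b). ennreal (x * of_bool (b p < x)) \<partial>(D \<Otimes>\<^sub>M marginal_others I q equilibrium))"
      unfolding win_def
      by (rule nn_integral_deviation[OF D _ others_q, symmetric]) (simp add: less_2_iff, measurable)
    moreover have "enn2ereal (\<integral>\<^sup>+ (x, b). ennreal (x * of_bool (b p < x))
        \<partial>(D \<Otimes>\<^sub>M marginal_others I q equilibrium)) \<le> ereal B"
    proof -
      have "deviation_expect q D (marginal_others I q equilibrium) (payment \<tau> I q)
          = expect (D \<Otimes>\<^sub>M marginal_others I q equilibrium) (\<lambda>(x, b). x * of_bool (b p < x))"
        by (simp add: deviation_expect_def outcome_q)
      also have "\<dots> = enn2ereal (\<integral>\<^sup>+ (x, b). ennreal (x * of_bool (b p < x))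
          \<partial>(D \<Otimes>\<^sub>M marginal_others I q equilibrium))"
        by (subst expect_nonneg_eq) (simp_all add: space_pair_measure space_D case_prod_unfold mem_Times_iff)
      finally show ?thesis
        using pay by simp
    qed
    ultimately show ?thesis
      using B by (simp add: less_eq_ennreal.rep_eq)
  qed
  \<comment> \<open>When \<open>q\<close> wins,
    \<open>V - x \<le> V = V * (1 - x / \<theta>) + V / \<theta> * x\<close>. The first summand may
    be negative, so splitting it off under \<open>ennreal\<close> gives only an inequality.\<close>
  have "ennreal ((V - x) * win x u) \<le> ennreal V *
      ennreal ((1 - x / \<theta>) * of_bool (equal_revenue_bid t u \<le> x / \<theta>))
      + ennreal (V / \<theta>) * ennreal (x * win x u)"
    if "0 \<le> x" for x u
  proof (cases "win x u = 0")
    case False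
    then have win: "win x u = 1" "equal_revenue_bid t u \<le> x / \<theta>"
      using \<theta> by (auto simp: win_def bid_def field_simps)
    have "ennreal (V - x) \<le> ennreal (V * (1 - x / \<theta>) + V / \<theta> * x)"
      using that by (intro ennreal_leI) (simp add: algebra_simps)
    also have "\<dots> \<le> ennreal (V * (1 - x / \<theta>)) + ennreal (V / \<theta> * x)"
      by (rule ennreal_plus_le)
    also have "\<dots> = ennreal V * ennreal (1 - x / \<theta>) + ennreal (V / \<theta>) * ennreal x"
      using B \<theta> by (subst (1 2) ennreal_mult') auto
    finally show ?thesis
      using win by simp
  qed simp
  then have "(\<integral>\<^sup>+ x. \<integral>\<^sup>+ u. ennreal ((V - x) * win x u) \<partial>unit_uniform \<partial>D)
      \<le> (\<integral>\<^sup>+ x. \<integral>\<^sup>+ u. ennreal V *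
          ennreal ((1 - x / \<theta>) * of_bool (equal_revenue_bid t u \<le> x / \<theta>))
          + ennreal (V / \<theta>) * ennreal (x * win x u) \<partial>unit_uniform \<partial>D)"
    using space_D by (intro nn_integral_mono) simp
  also have "\<dots> = (\<integral>\<^sup>+ x. ennreal V *
          (\<integral>\<^sup>+ u. ennreal ((1 - x / \<theta>) * of_bool (equal_revenue_bid t u \<le> x / \<theta>)) \<partial>unit_uniform)
          + ennreal (V / \<theta>) * (\<integral>\<^sup>+ u. ennreal (x * win x u) \<partial>unit_uniform) \<partial>D)"
    unfolding win_def
    by (simp add: nn_integral_add nn_integral_cmult measurable_unit_uniform)
  also have "\<dots> \<le> (\<integral>\<^sup>+ x. ennreal V * ennreal t
          + ennreal (V / \<theta>) * (\<integral>\<^sup>+ u. ennreal (x * win x u) \<partial>unit_uniform) \<partial>D)"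
    using space_D t \<theta>
    by (intro nn_integral_mono add_mono mult_left_mono equal_revenue_bid_cdf) auto
  also have "\<dots> = ennreal V * ennreal t
      + ennreal (V / \<theta>) * (\<integral>\<^sup>+ x. \<integral>\<^sup>+ u. ennreal (x * win x u) \<partial>unit_uniform \<partial>D)"
  proof -
    have "(\<lambda>(x, u). ennreal (x * win x u)) \<in> borel_measurable (D \<Otimes>\<^sub>M unit_uniform)"
    proof -
      have [measurable]: "(\<lambda>u. bid p u) \<in> borel_measurable unit_uniform"
        by (rule measurable_unit_uniform) measurable
      show ?thesis
        unfolding win_def by measurable
    qed
    from unit_uniform.borel_measurable_nn_integral_fst[OF this]
    have [measurable]: "(\<lambda>x. \<integral>\<^sup>+ u. ennreal (x * win x u) \<partial>unit_uniform) \<in> borel_measurable D"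
      by simp
    show ?thesis
      by (simp add: nn_integral_add nn_integral_cmult D.emeasure_space_1)
  qed
  also have "\<dots> \<le> ennreal V * ennreal t + ennreal (V / \<theta>) * ennreal B"
    by (intro add_mono mult_left_mono pay_le) auto
  also have "\<dots> = ennreal (V * (t + B / \<theta>))"
    using B \<theta> t by (simp add: algebra_simps flip: ennreal_mult ennreal_plus)
  also have "\<dots> \<le> ennreal (V * (1 - t) - B)"
    using slack by (rule ennreal_leI)
  finally have *: "(\<integral>\<^sup>+ x. \<integral>\<^sup>+ u. ennreal ((V - x) * win x u) \<partial>unit_uniform \<partial>D)
      \<le> ennreal (V * (1 - t) - B)" .
  \<comment> \<open>Nonnegativity of the bound is what allows it to be recovered from its
    \<open>ennreal\<close> image.\<close>
  have "0 \<le> V * (t + B / \<theta>)"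
    using B \<theta> t by simp
  with slack have nonneg: "0 \<le> V * (1 - t) - B"
    by linarith
  have "deviation_expect q D (marginal_others I q equilibrium) (utility \<tau> I q)
      = expect (D \<Otimes>\<^sub>M marginal_others I q equilibrium) (\<lambda>(x, b). (V - x) * of_bool (b p < x))"
    by (simp add: deviation_expect_def outcome_q)
  also have "\<dots> \<le> enn2ereal (\<integral>\<^sup>+ (x, b). ennreal ((V - x) * of_bool (b p < x))
      \<partial>(D \<Otimes>\<^sub>M marginal_others I q equilibrium))"
    by (rule order_trans[OF expect_le_nn_integral]) (simp add: case_prod_unfold)
  also have "(\<integral>\<^sup>+ (x, b). ennreal ((V - x) * of_bool (b p < x))
      \<partial>(D \<Otimes>\<^sub>M marginal_others I q equilibrium))
      = (\<integral>\<^sup>+ x. \<integral>\<^sup>+ u. ennreal ((V - x) * win x u) \<partial>unit_uniform \<partial>D)"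
    unfolding win_def by (rule nn_integral_deviation[OF D _ others_q]) (simp add: less_2_iff, measurable)
  also have "enn2ereal \<dots> \<le> enn2ereal (ennreal (V * (1 - t) - B))"
    using * by (simp add: less_eq_ennreal.rep_eq)
  finally show ?thesis
    using nonneg by simp
qed

section \<open>Expected outcomes in equilibrium\<close>

text \<open>Reduces an expectation over profiles to a Bochner integral over \<open>u\<close>:
  \<open>g\<close> expresses \<open>f\<close> through the two bids, and \<open>h\<close> is its
  simplified form on \<open>(0, 1]\<close>.\<close>

lemma expect_equilibrium:
  assumes "\<And>a. f a = g (a p) (a q)"
    and [measurable]: "(\<lambda>(x, y). g x y) \<in> borel_measurable (borel \<Otimes>\<^sub>M borel)"
    and "\<And>u. 0 < u \<Longrightarrow> u \<le> 1 \<Longrightarrow> g (bid p u) (bid q u) = h u"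
    and "has_bochner_integral unit_uniform h c"
  shows "expect equilibrium f = ereal c"
proof -
  have "p \<in> {..<2}" "q \<in> {..<2}"
    by (auto simp: less_2_iff)
  then have [measurable]: "(\<lambda>a. a p) \<in> borel_measurable (profile_space {..<2})"
      "(\<lambda>a. a q) \<in> borel_measurable (profile_space {..<2})"
    by (auto intro: measurable_profile_component)
  have "f \<in> borel_measurable (profile_space {..<2})"
    unfolding assms(1)[abs_def] by measurable
  then have "expect equilibrium f = expect unit_uniform (\<lambda>u. g (bid p u) (bid q u))"
    unfolding equilibrium_def
    by (subst expect_distr[OF measurable_bid_profile]) (auto simp: assms(1) less_2_iff)
  moreover have "has_bochner_integral unit_uniform (\<lambda>u. g (bid p u) (bid q u)) c"
    using assms(3,4) by (subst has_bochner_integral_cong) auto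
  ultimately show ?thesis
    by (simp add: expect_has_bochner_integral)
qed

text \<open>The bids differ by \<open>1 - \<theta>\<close> times the equal-revenue bid, which is
  zero exactly for \<open>u \<le> t\<close>.\<close>

lemma bid_q_le_bid_p_iff: "0 < u \<Longrightarrow> bid q u \<le> bid p u \<longleftrightarrow> u \<le> t"
  and bid_p_less_bid_q_iff: "0 < u \<Longrightarrow> bid p u < bid q u \<longleftrightarrow> t < u"
proof -
  have "bid q u \<le> bid p u \<longleftrightarrow> (1 - \<theta>) * equal_revenue_bid t u \<le> 0"
    by (simp add: bid_def algebra_simps)
  also have "\<dots> \<longleftrightarrow> equal_revenue_bid t u \<le> 0"
    using \<theta> by (simp add: mult_le_0_iff)
  finally show "0 < u \<Longrightarrow> bid q u \<le> bid p u \<longleftrightarrow> u \<le> t"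
    by (simp add: equal_revenue_bid_le_0_iff)
  then show "0 < u \<Longrightarrow> bid p u < bid q u \<longleftrightarrow> t < u"
    by auto
qed

lemma bid_eq_0: "0 < u \<Longrightarrow> u \<le> t \<Longrightarrow> bid i u = 0"
  by (simp add: bid_def equal_revenue_bid_eq)

lemma probability_p_wins: "has_bochner_integral unit_uniform (\<lambda>u. of_bool (u \<le> t)) t"
proof -
  have "has_bochner_integral unit_uniform (\<lambda>u. 1 - of_bool (t < u)) (1 - (1 - t))"
    using t unit_uniform.prob_space by (intro has_bochner_integral_diff probability_above)
      (auto simp: has_bochner_integral_iff)
  moreover have "(\<lambda>u. 1 - of_bool (t < u)) = (\<lambda>u. of_bool (u \<le> t) :: real)"
    by auto
  ultimately show ?thesis
    by simp
qed

text \<open>Value and utility agree because \<open>p\<close> wins only with bid 0 and so never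
  pays.\<close>

lemma expect_p:
  "expect equilibrium (\<lambda>a. valuation I p (slot \<tau> I a p)) = ereal t"
  "expect equilibrium (utility \<tau> I p) = ereal t"
  by (rule expect_equilibrium[OF outcome_p(1) _ _ probability_p_wins],
      measurable, simp add: bid_q_le_bid_p_iff)
    (rule expect_equilibrium[OF outcome_p(3) _ _ probability_p_wins],
      measurable, simp add: bid_q_le_bid_p_iff bid_eq_0)

text \<open>Since \<open>q\<close> loses only when bidding 0, her payment is always the
  equal-revenue bid itself. Its mean is \<open>B\<close>, so the budget is exactly
  exhausted.\<close>

lemma expect_q:
  "expect equilibrium (payment \<tau> I q) = ereal B"
  "expect equilibrium (utility \<tau> I q) = ereal (V * (1 - t) - B)"
proof -
  have *: "has_bochner_integral unit_uniform (equal_revenue_bid t) B"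
    unfolding B_eq using t by (rule integral_equal_revenue_bid)
  show "expect equilibrium (payment \<tau> I q) = ereal B"
    by (rule expect_equilibrium[OF outcome_q(2) _ _ *])
      (measurable, use t \<theta> in \<open>auto simp: bid_p_less_bid_q_iff bid_def equal_revenue_bid_eq\<close>)
  have "has_bochner_integral unit_uniform (\<lambda>u. V * of_bool (t < u) - equal_revenue_bid t u)
      (V * (1 - t) - B)"
    using t by (intro has_bochner_integral_diff has_bochner_integral_mult_right probability_above *)
  then show "expect equilibrium (utility \<tau> I q) = ereal (V * (1 - t) - B)"
    by (rule expect_equilibrium[OF outcome_q(3) _ _, rotated -1])
      (measurable, use t \<theta> in \<open>auto simp: bid_p_less_bid_q_iff bid_def equal_revenue_bid_eq\<close>)
qed

section \<open>Equilibrium property, liquid welfare and optimum\<close>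

lemma valid_instance: "valid_instance I"
  using B by (auto simp: valid_instance_def)

lemma coarse_correlated_equilibrium: "coarse_correlated_equilibrium \<tau> I equilibrium"
  using equilibrium_in_prob_algebra deviation_p deviation_q
  by (auto simp: coarse_correlated_equilibrium_def less_2_iff expect_p expect_q feasible_deviations_def)

lemma liquid_welfare_le: "liquid_welfare \<tau> I equilibrium \<le> ereal (B + t)"
proof -
  have "liquid_welfare \<tau> I equilibrium =
      ereal t + min (expect equilibrium (\<lambda>a. valuation I q (slot \<tau> I a q))) (ereal B)"
    unfolding liquid_welfare_def by (simp add: sum_bidders expect_p)
  also have "\<dots> \<le> ereal t + ereal B"
    by (intro add_left_mono min.cobounded2)
  finally show ?thesis
    by (simp add: add.commute)
qed

text \<open>Positivity is needed for division to be antitone in the denominator when the ratio is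
  bounded.\<close>

lemma liquid_welfare_pos: "0 < liquid_welfare \<tau> I equilibrium"
proof -
  have "0 \<le> expect equilibrium (\<lambda>a. valuation I q (slot \<tau> I a q))"
    using B by (subst expect_nonneg_eq) (auto simp: outcome_q)
  then have "0 < ereal t + min (expect equilibrium (\<lambda>a. valuation I q (slot \<tau> I a q))) (ereal B)"
    using B t by (intro add_pos_nonneg) auto
  then show ?thesis
    unfolding liquid_welfare_def by (simp add: sum_bidders expect_p)
qed

lemma optimal_liquid_welfare_ge: "ereal (B + 1 - B / V) \<le> optimal_liquid_welfare I"
proof -
  \<comment> \<open>The slot goes to \<open>q\<close> under \<open>alloc True\<close> and to
    \<open>p\<close> under \<open>alloc False\<close>; \<open>undefined\<close> makes the allocation
    extensional. With probability \<open>B / V\<close> of the former, the expected value of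
    \<open>q\<close> is exactly her budget.\<close>
  define alloc where "alloc c i = (if i < 2 then of_bool ((i = q) = c) else undefined :: nat)" for c i
  define \<xi> where "\<xi> = map_pmf alloc (bernoulli_pmf (B / V))"
  have prob: "0 \<le> B / V" "B / V \<le> 1"
    using B by auto
  have expect_\<xi>: "expect (measure_pmf \<xi>) f =
      ereal (B / V * f (alloc True) + (1 - B / V) * f (alloc False))" for f
  proof -
    have "integrable (measure_pmf \<xi>) f"
      unfolding \<xi>_def by (intro integrable_measure_pmf_finite) simp
    then show ?thesis
      using prob by (subst expect_has_bochner_integral[of _ _ "measure_pmf.expectation \<xi> f"])
        (auto simp: has_bochner_integral_iff \<xi>_def)
  qed
  have "ereal (B + 1 - B / V) = ereal (1 - B / V) + ereal B"
    by simp
  also have "\<dots> = (\<Sum>i<num_bidders I.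
      min (expect (measure_pmf \<xi>) (\<lambda>x. valuation I i (x i))) (budget I i))"
    using B by (simp add: sum_bidders expect_\<xi> valuation_def alloc_def less_2_iff)
  also have "\<dots> \<le> optimal_liquid_welfare I"
    unfolding optimal_liquid_welfare_def
  proof (rule SUP_upper, rule CollectI)
    have "alloc c \<in> feasible_allocations I" for c
      by (auto simp: alloc_def feasible_allocations_def less_2_iff split: if_splits)
    then show "set_pmf \<xi> \<subseteq> feasible_allocations I"
      by (auto simp: \<xi>_def)
  qed
  finally show ?thesis .
qed

lemma price_of_anarchy_ge: "ereal ((B + 1 - B / V) / (B + t)) \<le> price_of_anarchy \<tau>"
proof -
  have "B / V \<le> 1"
    using B by simp
  then have pos: "0 < B + 1 - B / V"
    using B by linarith
  then have "ereal ((B + 1 - B / V) / (B + t)) = ereal (B + 1 - B / V) / ereal (B + t)"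
    using B t by simp
  also have "\<dots> \<le> optimal_liquid_welfare I / ereal (B + t)"
    using optimal_liquid_welfare_ge B t by (intro ereal_divide_right_mono) auto
  also have "\<dots> \<le> optimal_liquid_welfare I / liquid_welfare \<tau> I equilibrium"
  proof (rule ereal_divide_left_mono[OF liquid_welfare_le])
    have "0 < ereal (B + 1 - B / V)"
      using pos by simp
    then show "0 < optimal_liquid_welfare I"
      using optimal_liquid_welfare_ge by (rule less_le_trans)
    show "0 < ereal (B + t) * liquid_welfare \<tau> I equilibrium"
      using liquid_welfare_pos B(1) t(1) by (simp add: ereal_zero_less_0_iff)
  qed
  also have "\<dots> \<le> price_of_anarchy \<tau>"
    unfolding price_of_anarchy_def using valid_instance coarse_correlated_equilibrium
    by (intro SUP_upper2[of "(I, equilibrium)"]) auto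
  finally show ?thesis .
qed

end

section \<open>The constant \<open>t\<close> and the limit of large values\<close>

text \<open>The defining equation reads \<open>t * exp (- t) = exp (- 2)\<close>; its logarithm is
  the last claim, and \<open>t = 1\<close> would give \<open>exp (- 1) = exp (- 2)\<close>.\<close>

lemma lambert_W0_at_minus_exp_minus_2:
  defines "t \<equiv> - lambert_W0 (- exp (- 2))"
  shows "0 < t" "t < 1" "ln t = t - 2"
proof -
  have "- exp (- 1) \<le> - exp (- 2 :: real)"
    by simp
  from theI'[OF lambert_W0_unique[OF this]]
  have t: "t \<le> 1" "t * exp (- t) = exp (- 2)"
    by (auto simp: t_def lambert_W0_def)
  have "0 < t * exp (- t)"
    using t by simp
  then show "0 < t"
    by (simp add: zero_less_mult_iff)
  have "t \<noteq> 1"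
    using t(2) by auto
  then show "t < 1"
    using t by simp
  have "ln (t * exp (- t)) = - 2"
    using t by simp
  then show "ln t = t - 2"
    using \<open>0 < t\<close> by (simp add: ln_mult)
qed

theorem theorem6p2:
  fixes \<tau> :: "nat \<Rightarrow> nat \<Rightarrow> nat"
  assumes "tie_breaking \<tau>"
  shows "ereal ((2 + lambert_W0 (- exp (- 2))) / (1 + lambert_W0 (- exp (- 2)))) \<le> price_of_anarchy \<tau>"
proof -
  define t where "t = - lambert_W0 (- exp (- 2))"
  have t: "0 < t" "t < 1" "ln t = t - 2"
    using lambert_W0_at_minus_exp_minus_2 by (simp_all add: t_def)
  define B where "B = 1 - t + t * ln t"
  have B_eq: "B = 1 - 3 * t + t\<^sup>2"
    by (simp add: B_def t(3) power2_eq_square algebra_simps)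
  \<comment> \<open>Strict because \<open>1 / t \<noteq> 1\<close>; multiplied by \<open>t\<close>,
    this becomes \<open>0 < B\<close>.\<close>
  have "ln (1 / t) < 1 / t - 1"
    using t ln_le_minus_one[of "1 / t"] ln_eq_minus_one[of "1 / t"] by fastforce
  then have "t * (1 - 1 / t) < t * ln t"
    using t by (intro mult_strict_left_mono) (auto simp: ln_div)
  then have B: "0 < B"
    using t(1,2) by (simp add: B_def algebra_simps)
  \<comment> \<open>Half of the gap \<open>(1 - t) - (t + B) = t - t\<^sup>2\<close>: one half is
    spent on \<open>\<theta> < 1\<close>, the other is left for the payment of
    \<open>q\<close>.\<close>
  define s where "s = (t - t\<^sup>2) / 2"
  have s: "0 < s"
    using t by (simp add: s_def power2_eq_square)
  define \<theta> where "\<theta> = B / (B + s)"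
  have \<theta>: "0 < \<theta>" "\<theta> < 1" "B / \<theta> = B + s"
    using B s by (auto simp: \<theta>_def)
  have tB: "t + (B + s) = 1 - t - s"
    by (simp add: B_eq s_def field_simps)
  \<comment> \<open>The bidder favoured by \<tau> among bidders 0 and 1.\<close>
  define p :: nat where "p = of_bool (\<tau> 2 1 < \<tau> 2 0)"
  have "\<tau> 2 0 \<noteq> \<tau> 2 1"
    using assms inj_onD[of "\<tau> 2" "{..<2}" 0 1] by (auto simp: tie_breaking_def)
  then have bidders: "{..<2} = {p, 1 - p}" "\<tau> 2 p < \<tau> 2 (1 - p)"
    by (auto simp: p_def of_bool_def)
  have bound: "ereal ((B + 1 - B / V) / (B + t)) \<le> price_of_anarchy \<tau>" if V: "B \<le> V" "B / s \<le> V" for V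
  proof -
    \<comment> \<open>By \<open>tB\<close>, this is exactly the condition
      \<open>slack\<close>.\<close>
    have "B \<le> V * s"
      using V s by (simp add: field_simps)
    then have "V * (t + B / \<theta>) \<le> V * (1 - t) - B"
      unfolding \<theta>(3) tB by (simp add: algebra_simps)
    with bidders t(1,2) \<theta>(1,2) B B_def V(1) interpret two_bidder_example \<tau> p "1 - p" t \<theta> V B
      by unfold_locales
    show ?thesis
      by (rule price_of_anarchy_ge)
  qed
  \<comment> \<open>The bound holds for all large \<open>V\<close>, so it passes to the
    limit.\<close>
  have "((\<lambda>V. (B + 1 - B / V) / (B + t)) \<longlongrightarrow> (B + 1 - 0) / (B + t)) at_top"
    using B t by (intro tendsto_intros tendsto_divide_0[OF tendsto_const]
        filterlim_at_top_imp_at_infinity filterlim_ident) auto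
  then have "((\<lambda>V. ereal ((B + 1 - B / V) / (B + t))) \<longlongrightarrow> ereal ((B + 1) / (B + t))) at_top"
    by simp
  then have "ereal ((B + 1) / (B + t)) \<le> price_of_anarchy \<tau>"
    by (rule tendsto_upperbound)
      (auto intro!: eventually_at_top_linorderI[of "max B (B / s)"] bound)
  moreover have "(B + 1) / (B + t) = (2 - t) / (1 - t)"
  proof -
    have "B + 1 = (2 - t) * (1 - t)" "B + t = (1 - t) * (1 - t)"
      by (simp_all add: B_eq power2_eq_square algebra_simps)
    then show ?thesis
      using t by simp
  qed
  ultimately show ?thesis
    by (simp add: t_def)
qed

end
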